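(* Let $\gamma : I\to\mathbb{R}^3$ be a smooth curve on an open interval $I$ parametrized by arc length $s$, with nowhere vanishing curvature and unit tangent $T$. Let $c$ be a real constant with $c-s>0$ for all $s\in I$, and let $\widetilde\gamma=\gamma+(c-s)T$ be the involute of $\gamma$ (so that $\gamma$ is the evolute of $\widetilde\gamma$). Then $\widetilde\gamma$ is a generalized helix if and only if its evolute $\gamma$ is a slant helix.
   Context: For a curve with arc-length parameter $u$, curvature $k>0$ and torsion $t$, put $g=t/k$. The curve is a generalized helix if $g$ is constant (the value $0$ is allowed). The curve is a slant helix if its principal normal lines make a constant angle with a fixed direction; equivalently (known characterization of Izumiya and Takeuchi), the function $\frac{dg/du}{k(1+g^2)^{3/2}}$ is constant. *)

theory Defs
  imports "HOL-Analysis.Analysis"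
begin

definition vderiv :: "(real \<Rightarrow> 'a::real_normed_vector) \<Rightarrow> real \<Rightarrow> 'a" where
  "vderiv f = (\<lambda>s. vector_derivative f (at s))"

text \<open>The derivatives are two-sided, so the following notion of \<open>C\<^sup>\<infinity>\<close> is only used on open
  sets. Functions are total; their values off \<open>I\<close> are irrelevant.\<close>

definition smooth_on :: "real set \<Rightarrow> (real \<Rightarrow> 'a::real_normed_vector) \<Rightarrow> bool" where
  "smooth_on I f \<longleftrightarrow> (\<forall>n. \<forall>s\<in>I. (vderiv ^^ n) f differentiable (at s))"

definition unit_speed_on :: "real set \<Rightarrow> (real \<Rightarrow> real^3) \<Rightarrow> bool" where
  "unit_speed_on I \<gamma> \<longleftrightarrow> smooth_on I \<gamma> \<and> (\<forall>s\<in>I. norm (vderiv \<gamma> s) = 1)"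

text \<open>The Frenet apparatus below is that of a curve parametrized by arc length; it is not meant
  for curves of other speed. The sign of the torsion is fixed by \<open>B' = - t N\<close>.\<close>

definition unit_tangent :: "(real \<Rightarrow> real^3) \<Rightarrow> real \<Rightarrow> real^3" where
  "unit_tangent \<gamma> = vderiv \<gamma>"

definition curvature :: "(real \<Rightarrow> real^3) \<Rightarrow> real \<Rightarrow> real" where
  "curvature \<gamma> s = norm (vderiv (unit_tangent \<gamma>) s)"

definition principal_normal :: "(real \<Rightarrow> real^3) \<Rightarrow> real \<Rightarrow> real^3" where
  "principal_normal \<gamma> s = vderiv (unit_tangent \<gamma>) s /\<^sub>R curvature \<gamma> s"

definition binormal :: "(real \<Rightarrow> real^3) \<Rightarrow> real \<Rightarrow> real^3" where
  "binormal \<gamma> s = cross3 (unit_tangent \<gamma> s) (principal_normal \<gamma> s)"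

definition torsion :: "(real \<Rightarrow> real^3) \<Rightarrow> real \<Rightarrow> real" where
  "torsion \<gamma> s = - (vderiv (binormal \<gamma>) s \<bullet> principal_normal \<gamma> s)"

text \<open>\<open>\<beta>\<close> on the open interval \<open>J\<close> is an orientation-preserving arc-length reparametrization of \<open>\<alpha>\<close>
  on \<open>I\<close>, with arc-length parameter \<open>u = \<phi> s\<close>.\<close>

definition arclength_reparam ::
  "real set \<Rightarrow> (real \<Rightarrow> real^3) \<Rightarrow> real set \<Rightarrow> (real \<Rightarrow> real^3) \<Rightarrow> (real \<Rightarrow> real) \<Rightarrow> bool" where
  "arclength_reparam I \<alpha> J \<beta> \<phi> \<longleftrightarrow>
     open J \<and> is_interval J \<and> unit_speed_on J \<beta> \<and>
     bij_betw \<phi> I J \<and> smooth_on I \<phi> \<and> (\<forall>s\<in>I. vderiv \<phi> s > 0) \<and>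
     (\<forall>s\<in>I. \<alpha> s = \<beta> (\<phi> s))"

text \<open>An involute is not parametrized by arc length, hence the passage to an arc-length
  reparametrization. The latter is unique up to a translation of the parameter, so the choice
  does not matter.\<close>

definition generalized_helix :: "real set \<Rightarrow> (real \<Rightarrow> real^3) \<Rightarrow> bool" where
  "generalized_helix I \<alpha> \<longleftrightarrow>
     (\<exists>J \<beta> \<phi>. arclength_reparam I \<alpha> J \<beta> \<phi> \<and>
        (\<forall>u\<in>J. curvature \<beta> u > 0) \<and>
        (\<exists>m. \<forall>u\<in>J. torsion \<beta> u / curvature \<beta> u = m))"

text \<open>Lines carry no orientation, so the angle between two of them lies in \<open>[0, pi/2]\<close>.\<close>

definition line_angle :: "'a::real_inner \<Rightarrow> 'a \<Rightarrow> real" where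
  "line_angle x y = arccos (\<bar>x \<bullet> y\<bar> / (norm x * norm y))"

text \<open>For unit-speed curves with nowhere vanishing curvature.\<close>

definition slant_helix :: "real set \<Rightarrow> (real \<Rightarrow> real^3) \<Rightarrow> bool" where
  "slant_helix I \<gamma> \<longleftrightarrow>
     (\<exists>d \<theta>. d \<noteq> 0 \<and> (\<forall>s\<in>I. line_angle (principal_normal \<gamma> s) d = \<theta>))"

definition involute :: "real \<Rightarrow> (real \<Rightarrow> real^3) \<Rightarrow> real \<Rightarrow> real^3" where
  "involute c \<gamma> s = \<gamma> s + (c - s) *\<^sub>R unit_tangent \<gamma> s"

end

theory Submission imports Defs begin

text \<open>By the Frenet equations, the derivative of the involute is \<open>((c - s) k) N\<close>, a positive multiple of
the principal normal of \<open>\<gamma>\<close>. Hence the unit tangent of any arc-length reparametrization of the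
involute is \<open>N\<close>, transported along the change of parameter, and both sides of the equivalence say
that \<open>N \<bullet> d\<close> is constant for some vector \<open>d \<noteq> 0\<close>:

For the involute this is Lancret's theorem (\<open>lancret\<close>): torsion over curvature is constant if and
only if the unit tangent makes a constant angle with a fixed direction. It applies because the
curvature of the involute cannot vanish: differentiating \<open>T \<bullet> N = 0\<close> gives \<open>T \<bullet> N' = - k \<noteq> 0\<close>.

For \<open>\<gamma>\<close> the angle between the lines spanned by \<open>N\<close> and \<open>d\<close> only determines \<open>\<bar>N \<bullet> d\<bar>\<close>, but \<open>N \<bullet> d\<close>
is continuous on an interval and takes at most two values, so it is constant
(\<open>slant_helix_iff_normal_inner_constant\<close>).

What remains is that an arc-length reparametrization exists at all (\<open>exists_arclength_reparam\<close>).
Its smoothness rests on the closure of smooth functions under products, composition, and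
solutions of autonomous differential equations, the last of which covers reciprocals, square roots
and inverse functions uniformly.\<close>

section \<open>Closure properties of smooth functions\<close>

text \<open>The number of derivatives is a separate parameter so that closure properties can be proved by
induction: one derivative of a product or a composite involves the original factors as well, and
for these one derivative less is still available. Peeling off the first derivative, not the last,
is what makes the product and chain rules usable in the induction step.\<close>

primrec ndiff :: "nat \<Rightarrow> real set \<Rightarrow> (real \<Rightarrow> 'a::real_normed_vector) \<Rightarrow> bool" where
  "ndiff 0 I f = True"
| "ndiff (Suc n) I f = ((\<forall>s\<in>I. f differentiable (at s)) \<and> ndiff n I (vderiv f))"

lemma ndiff_iff: "ndiff n I f \<longleftrightarrow> (\<forall>k<n. \<forall>s\<in>I. (vderiv ^^ k) f differentiable (at s))"
  by (induction n arbitrary: f)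
     (auto simp: less_Suc_eq_0_disj funpow_Suc_right simp del: funpow.simps(2))

lemma smooth_on_iff_ndiff: "smooth_on I f \<longleftrightarrow> (\<forall>n. ndiff n I f)"
  unfolding smooth_on_def ndiff_iff by blast

lemma ndiff_SucD: "ndiff (Suc n) I f \<Longrightarrow> ndiff n I f"
  by (simp add: ndiff_iff)

lemma has_vector_derivative_vderiv:
  "f differentiable (at s) \<Longrightarrow> (f has_vector_derivative vderiv f s) (at s)"
  by (simp add: vderiv_def vector_derivative_works)

lemma vderiv_eqI: "(f has_vector_derivative d) (at s) \<Longrightarrow> vderiv f s = d"
  by (simp add: vderiv_def vector_derivative_at)

text \<open>The derivatives are two-sided, so that values on an open set determine them there.\<close>

lemma ndiff_cong:
  assumes "open I" "\<And>s. s \<in> I \<Longrightarrow> f s = g s" "ndiff n I f"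
  shows "ndiff n I g"
  using assms(2,3)
proof (induction n arbitrary: f g)
  case (Suc n)
  have der: "(g has_vector_derivative vderiv f s) (at s)" if "s \<in> I" for s
  proof (rule has_vector_derivative_transform_within_open[OF _ assms(1) that Suc.prems(1)])
    show "(f has_vector_derivative vderiv f s) (at s)"
      using Suc.prems(2) that by (simp add: has_vector_derivative_vderiv)
  qed
  have "ndiff n I (vderiv g)"
    by (rule Suc.IH[OF vderiv_eqI[OF der, symmetric]]) (use Suc.prems(2) in auto)
  then show ?case
    using differentiableI_vector[OF der] by simp
qed simp

text \<open>This is how the closure rules are proved: it suffices to exhibit some derivative on \<open>I\<close>, which need
not be the total function \<open>vderiv f\<close>.\<close>

lemma ndiff_SucI:
  assumes "open I" "\<And>s. s \<in> I \<Longrightarrow> (f has_vector_derivative g s) (at s)" "ndiff n I g"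
  shows "ndiff (Suc n) I f"
proof -
  have "ndiff n I (vderiv f)"
    by (rule ndiff_cong[OF assms(1) vderiv_eqI[OF assms(2), symmetric] assms(3)])
  then show ?thesis
    using differentiableI_vector[OF assms(2)] by simp
qed

lemma ndiff_SucE:
  assumes "ndiff (Suc n) I f"
  obtains "\<And>s. s \<in> I \<Longrightarrow> (f has_vector_derivative vderiv f s) (at s)" "ndiff n I (vderiv f)"
  using assms by (auto intro: has_vector_derivative_vderiv)

lemma ndiff_add:
  assumes "open I" "ndiff n I f" "ndiff n I g"
  shows "ndiff n I (\<lambda>s. f s + g s)"
  using assms(2,3)
proof (induction n arbitrary: f g)
  case (Suc n)
  then show ?case
    by (elim ndiff_SucE, intro ndiff_SucI[OF assms(1), where g = "\<lambda>s. vderiv f s + vderiv g s"])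
       (simp_all add: has_vector_derivative_add)
qed simp

lemma ndiff_bilinear:
  assumes "bounded_bilinear h" "open I" "ndiff n I f" "ndiff n I g"
  shows "ndiff n I (\<lambda>s. h (f s) (g s))"
  using assms(3,4)
proof (induction n arbitrary: f g)
  case (Suc n)
  then have "ndiff n I f" "ndiff n I g"
    by (blast intro: ndiff_SucD)+
  with Suc show ?case
    by (elim ndiff_SucE, intro ndiff_SucI[OF assms(2),
          where g = "\<lambda>s. h (f s) (vderiv g s) + h (vderiv f s) (g s)"])
       (auto intro!: bounded_bilinear.has_vector_derivative[OF assms(1)] ndiff_add[OF assms(2)])
qed simp

lemma ndiff_compose:
  assumes "open I" "\<phi> ` I \<subseteq> J" "ndiff n J f" "ndiff n I \<phi>"
  shows "ndiff n I (\<lambda>s. f (\<phi> s))"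
  using assms(3,4)
proof (induction n arbitrary: f)
  case (Suc n)
  have "ndiff n I \<phi>"
    using Suc.prems by (blast intro: ndiff_SucD)
  with Suc show ?case
    using assms(2)
    by (elim ndiff_SucE, intro ndiff_SucI[OF assms(1),
          where g = "\<lambda>s. vderiv \<phi> s *\<^sub>R vderiv f (\<phi> s)"])
       (auto intro!: vector_diff_chain_at[unfolded o_def] ndiff_bilinear[OF bounded_bilinear_scaleR assms(1)])
qed simp

lemma smooth_onD:
  assumes "smooth_on I f" "s \<in> I"
  shows "(f has_vector_derivative vderiv f s) (at s)"
proof (rule has_vector_derivative_vderiv)
  have "(vderiv ^^ 0) f differentiable (at s)"
    using assms unfolding smooth_on_def by blast
  then show "f differentiable (at s)" by simp
qed

lemma smooth_on_vderiv:
  assumes "smooth_on I f"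
  shows "smooth_on I (vderiv f)"
  unfolding smooth_on_def
proof (intro allI ballI)
  fix n s assume "s \<in> I"
  then have "(vderiv ^^ Suc n) f differentiable (at s)"
    using assms unfolding smooth_on_def by blast
  then show "(vderiv ^^ n) (vderiv f) differentiable (at s)"
    unfolding funpow_Suc_right by simp
qed

lemma smooth_onI:
  assumes "open I" "\<And>s. s \<in> I \<Longrightarrow> (f has_vector_derivative g s) (at s)" "smooth_on I g"
  shows "smooth_on I f"
  unfolding smooth_on_iff_ndiff
proof
  fix n
  have "ndiff n I g"
    using assms(3) unfolding smooth_on_iff_ndiff by blast
  from ndiff_SucI[OF assms(1,2) this] show "ndiff n I f"
    by (rule ndiff_SucD)
qed

lemma smooth_on_continuous_on: "smooth_on I f \<Longrightarrow> continuous_on I f"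
  by (intro continuous_at_imp_continuous_on ballI has_vector_derivative_continuous[OF smooth_onD])

lemma smooth_on_add:
  "\<lbrakk>open I; smooth_on I f; smooth_on I g\<rbrakk> \<Longrightarrow> smooth_on I (\<lambda>s. f s + g s)"
  by (simp add: smooth_on_iff_ndiff ndiff_add)

lemma smooth_on_bilinear:
  "\<lbrakk>bounded_bilinear h; open I; smooth_on I f; smooth_on I g\<rbrakk> \<Longrightarrow> smooth_on I (\<lambda>s. h (f s) (g s))"
  by (simp add: smooth_on_iff_ndiff ndiff_bilinear)

lemma smooth_on_compose:
  "\<lbrakk>open I; \<phi> ` I \<subseteq> J; smooth_on J f; smooth_on I \<phi>\<rbrakk> \<Longrightarrow> smooth_on I (\<lambda>s. f (\<phi> s))"
  by (simp add: smooth_on_iff_ndiff ndiff_compose)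

lemma smooth_on_const: "open I \<Longrightarrow> smooth_on I (\<lambda>s. a)"
proof -
  have "ndiff n I (\<lambda>s. b)" if "open I" for n and b :: 'a
  proof (induction n arbitrary: b)
    case (Suc n)
    show ?case
      by (rule ndiff_SucI[OF that has_vector_derivative_const Suc])
  qed simp
  then show "open I \<Longrightarrow> smooth_on I (\<lambda>s. a)"
    by (simp add: smooth_on_iff_ndiff)
qed

text \<open>Bootstrapping: if \<open>\<psi>\<close> has \<open>n\<close> derivatives, then so does \<open>F \<circ> \<psi> = \<psi>'\<close>, and \<open>\<psi>\<close> has \<open>n + 1\<close>. Reciprocals
satisfy \<open>y' = - y\<^sup>2\<close>, square roots \<open>y' = 1 / (2 y)\<close>, and the inverse of a function with derivative
\<open>v\<close> satisfies \<open>y' = 1 / v(y)\<close>.\<close>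

lemma smooth_on_autonomous_solution:
  assumes "open I" "\<psi> ` I \<subseteq> J" "smooth_on J F"
    and der: "\<And>s. s \<in> I \<Longrightarrow> (\<psi> has_vector_derivative F (\<psi> s)) (at s)"
  shows "smooth_on I \<psi>"
proof -
  have "ndiff n I \<psi>" for n
  proof (induction n)
    case (Suc n)
    have "ndiff n J F"
      using assms(3) by (simp add: smooth_on_iff_ndiff)
    then have "ndiff n I (\<lambda>s. F (\<psi> s))"
      using Suc by (rule ndiff_compose[OF assms(1,2)])
    then show ?case
      using ndiff_SucI[OF assms(1) der] by simp
  qed simp
  then show ?thesis by (simp add: smooth_on_iff_ndiff)
qed

lemma smooth_on_ident: "open I \<Longrightarrow> smooth_on I (\<lambda>s. s)"
  by (rule smooth_onI[where g = "\<lambda>s. 1"]) (auto intro: smooth_on_const)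

lemma smooth_on_uminus: "\<lbrakk>open I; smooth_on I f\<rbrakk> \<Longrightarrow> smooth_on I (\<lambda>s. - f s)"
  using smooth_on_bilinear[OF bounded_bilinear_scaleR _ smooth_on_const, of I f "-1"] by simp

lemma smooth_on_inverse:
  fixes f :: "real \<Rightarrow> real"
  assumes "open I" "smooth_on I f" "\<And>s. s \<in> I \<Longrightarrow> f s \<noteq> 0"
  shows "smooth_on I (\<lambda>s. inverse (f s))"
proof -
  have "smooth_on (- {0}) (inverse :: real \<Rightarrow> real)"
  proof (rule smooth_on_autonomous_solution[where F = "\<lambda>y. - (y * y)" and J = UNIV])
    show "smooth_on UNIV (\<lambda>y::real. - (y * y))"
      by (intro smooth_on_uminus smooth_on_bilinear[OF bounded_bilinear_mult] smooth_on_ident open_UNIV)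
    show "(inverse has_vector_derivative - (inverse s * inverse s)) (at s)"
      if "s \<in> - {0}" for s :: real
      using that DERIV_inverse[of s]
      by (simp add: has_real_derivative_iff_has_vector_derivative power2_eq_square)
  qed auto
  then show ?thesis
    by (rule smooth_on_compose[OF assms(1) _ _ assms(2), rotated]) (use assms(3) in auto)
qed

lemma smooth_on_norm:
  fixes f :: "real \<Rightarrow> 'a::real_inner"
  assumes "open I" "smooth_on I f" "\<And>s. s \<in> I \<Longrightarrow> f s \<noteq> 0"
  shows "smooth_on I (\<lambda>s. norm (f s))"
proof -
  have "smooth_on {0<..} sqrt"
  proof (rule smooth_on_autonomous_solution[where F = "\<lambda>y. inverse (2 * y)" and J = "{0<..}"])
    have "smooth_on {0<..} (\<lambda>y::real. 2 * y)"
      by (intro smooth_on_bilinear[OF bounded_bilinear_mult] smooth_on_ident smooth_on_const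
          open_greaterThan)
    then show "smooth_on {0<..} (\<lambda>y::real. inverse (2 * y))"
      by (intro smooth_on_inverse) auto
    show "(sqrt has_vector_derivative inverse (2 * sqrt s)) (at s)" if "s \<in> {0<..}" for s
      using that DERIV_real_sqrt[of s]
      by (simp add: has_real_derivative_iff_has_vector_derivative divide_simps mult.commute)
  qed auto
  moreover have "smooth_on I (\<lambda>s. f s \<bullet> f s)"
    by (intro smooth_on_bilinear[OF bounded_bilinear_inner] assms)
  ultimately have "smooth_on I (\<lambda>s. sqrt (f s \<bullet> f s))"
    by (rule smooth_on_compose[OF assms(1), rotated]) (use assms(3) in auto)
  then show ?thesis by (simp add: norm_eq_sqrt_inner)
qed

lemma smooth_on_scaleR:
  "\<lbrakk>open I; smooth_on I f; smooth_on I g\<rbrakk> \<Longrightarrow> smooth_on I (\<lambda>s. f s *\<^sub>R g s)"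
  by (rule smooth_on_bilinear[OF bounded_bilinear_scaleR])

section \<open>The Frenet equations\<close>

lemma bounded_bilinear_cross3: "bounded_bilinear cross3"
  using bilinear_cross bilinear_conv_bounded_bilinear by blast

lemma cross3_triple_right: "cross3 x (cross3 y z) = (x \<bullet> z) *\<^sub>R y - (x \<bullet> y) *\<^sub>R z"
  by (simp add: cross3_simps forall_3)

lemma inner_constant_imp_orthogonal_derivative:
  assumes "open I" "s \<in> I" "\<And>r. r \<in> I \<Longrightarrow> f r \<bullet> g r = a"
    and "(f has_vector_derivative f') (at s)" "(g has_vector_derivative g') (at s)"
  shows "f s \<bullet> g' + f' \<bullet> g s = 0"
proof -
  have "((\<lambda>r. f r \<bullet> g r) has_vector_derivative f s \<bullet> g' + f' \<bullet> g s) (at s)"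
    by (rule bounded_bilinear.has_vector_derivative[OF bounded_bilinear_inner assms(4,5)])
  moreover have "((\<lambda>r. f r \<bullet> g r) has_vector_derivative 0) (at s)"
    by (rule has_vector_derivative_transform_within_open[of "\<lambda>r. a"])
       (use assms in auto)
  ultimately show ?thesis
    by (rule vector_derivative_unique_at)
qed

locale frenet_curve =
  fixes J :: "real set" and \<beta> :: "real \<Rightarrow> real^3"
  assumes open_J: "open J" and unit_speed: "unit_speed_on J \<beta>"
    and curvature_nonzero: "\<And>u. u \<in> J \<Longrightarrow> curvature \<beta> u \<noteq> 0"
begin

abbreviation "T \<equiv> unit_tangent \<beta>"
abbreviation "N \<equiv> principal_normal \<beta>"
abbreviation "B \<equiv> binormal \<beta>"

lemma curvature_pos: "u \<in> J \<Longrightarrow> curvature \<beta> u > 0"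
  using curvature_nonzero[of u] by (simp add: curvature_def)

lemma smooth_tangent: "smooth_on J T"
  using unit_speed unfolding unit_speed_on_def unit_tangent_def by (blast intro: smooth_on_vderiv)

lemma smooth_curvature: "smooth_on J (curvature \<beta>)"
  unfolding curvature_def using curvature_nonzero
  by (intro smooth_on_norm open_J smooth_on_vderiv smooth_tangent) (auto simp: curvature_def)

lemma smooth_normal: "smooth_on J N"
  unfolding principal_normal_def using curvature_nonzero
  by (intro smooth_on_scaleR open_J smooth_on_inverse smooth_curvature smooth_on_vderiv
      smooth_tangent) auto

text \<open>Since \<open>N\<close> is \<open>T'\<close> scaled to unit length, \<open>T \<bullet> N = 0\<close> comes from differentiating \<open>T \<bullet> T = 1\<close>.\<close>

lemma orthonormal:
  assumes "u \<in> J"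
  shows "T u \<bullet> T u = 1" "N u \<bullet> N u = 1" "T u \<bullet> N u = 0"
proof -
  have *: "T r \<bullet> T r = 1" if "r \<in> J" for r
    using unit_speed that by (simp add: unit_speed_on_def unit_tangent_def dot_square_norm)
  show "T u \<bullet> T u = 1" using * assms .
  show "N u \<bullet> N u = 1"
    using curvature_nonzero[OF assms]
    by (simp add: principal_normal_def dot_square_norm curvature_def power2_eq_square)
  have "T u \<bullet> vderiv T u = 0"
    using inner_constant_imp_orthogonal_derivative[OF open_J assms *
        smooth_onD smooth_onD, OF _ smooth_tangent assms smooth_tangent assms]
    by (simp add: inner_commute)
  then show "T u \<bullet> N u = 0"
    by (simp add: principal_normal_def)
qed

lemma norm_normal: "u \<in> J \<Longrightarrow> norm (N u) = 1"
  using orthonormal(2) by (simp add: norm_eq_1)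

lemma norm_binormal:
  assumes "u \<in> J"
  shows "norm (B u) = 1"
proof -
  have "norm (T u) = 1"
    using orthonormal(1)[OF assms] by (simp add: norm_eq_1)
  then have "(norm (B u))\<^sup>2 = 1"
    using norm_cross_dot[of "T u" "N u"] orthonormal(3)[OF assms] norm_normal[OF assms]
    by (simp add: binormal_def)
  then show ?thesis
    using norm_ge_zero[of "B u"] by (simp add: power2_eq_1_iff)
qed

lemma frenet_tangent:
  assumes "u \<in> J"
  shows "(T has_vector_derivative curvature \<beta> u *\<^sub>R N u) (at u)"
  using smooth_onD[OF smooth_tangent assms] curvature_nonzero[OF assms]
  by (simp add: principal_normal_def)

text \<open>As \<open>T'\<close> is parallel to \<open>N\<close>, the product rule leaves \<open>B' = T \<times> N'\<close>. Both factors are orthogonal to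
\<open>N\<close>, so \<open>B'\<close> is parallel to \<open>N\<close>, and its component along \<open>N\<close> is \<open>- t\<close> by definition of the torsion.\<close>

lemma frenet_binormal:
  assumes "u \<in> J"
  shows "(B has_vector_derivative - torsion \<beta> u *\<^sub>R N u) (at u)"
proof -
  let ?N' = "vderiv N u"
  have N': "(N has_vector_derivative ?N') (at u)"
    using smooth_onD[OF smooth_normal assms] .
  have "N u \<bullet> ?N' = 0"
    using inner_constant_imp_orthogonal_derivative[OF open_J assms orthonormal(2) N' N']
    by (simp add: inner_commute)
  have B': "(B has_vector_derivative cross3 (T u) ?N') (at u)"
    using bounded_bilinear.has_vector_derivative[OF bounded_bilinear_cross3
        frenet_tangent[OF assms] N']
    by (simp add: binormal_def[abs_def] cross_mult_left)
  \<comment> \<open>\<open>N \<times> B' = 0\<close>, so \<open>B'\<close> is a multiple of the unit vector \<open>N\<close>.\<close>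
  have "cross3 (N u) (cross3 (T u) ?N') = 0"
    using \<open>N u \<bullet> ?N' = 0\<close> orthonormal(3)[OF assms]
    by (simp add: cross3_triple_right inner_commute)
  then have "cross3 (N u) (cross3 (N u) (cross3 (T u) ?N')) = 0"
    by simp
  then have "cross3 (T u) ?N' = (N u \<bullet> cross3 (T u) ?N') *\<^sub>R N u"
    unfolding cross3_triple_right[of "N u" "N u"] using orthonormal(2)[OF assms] by simp
  also have "N u \<bullet> cross3 (T u) ?N' = - torsion \<beta> u"
    using B' by (simp add: torsion_def vderiv_eqI inner_commute)
  finally show ?thesis using B' by simp
qed

text \<open>Differentiating \<open>N = B \<times> T\<close> reduces this equation to those for \<open>T\<close> and \<open>B\<close>.\<close>

lemma frenet_normal:
  assumes "u \<in> J"
  shows "(N has_vector_derivative torsion \<beta> u *\<^sub>R B u - curvature \<beta> u *\<^sub>R T u) (at u)"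
proof -
  have BT: "cross3 (B r) (T r) = N r" if "r \<in> J" for r
    using orthonormal[OF that] cross_skew[of "B r" "T r"]
    by (simp add: binormal_def cross3_triple_right)
  have BN: "cross3 (B u) (N u) = - T u"
    using orthonormal[OF assms] cross_skew[of "B u" "N u"]
    by (simp add: binormal_def cross3_triple_right inner_commute)
  have NT: "cross3 (N u) (T u) = - B u"
    using cross_skew[of "N u" "T u"] by (simp add: binormal_def)
  have "((\<lambda>r. cross3 (B r) (T r)) has_vector_derivative
      torsion \<beta> u *\<^sub>R B u - curvature \<beta> u *\<^sub>R T u) (at u)"
    using bounded_bilinear.has_vector_derivative[OF bounded_bilinear_cross3
        frenet_binormal[OF assms] frenet_tangent[OF assms]]
    by (simp add: cross_mult_left cross_mult_right BN NT)
  then show ?thesis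
    by (rule has_vector_derivative_transform_within_open[OF _ open_J assms BT])
qed

end

section \<open>Lancret's theorem and slant helices\<close>

lemma zero_derivative_imp_constant:
  fixes f :: "real \<Rightarrow> 'a::euclidean_space"
  assumes "is_interval I" "\<And>s. s \<in> I \<Longrightarrow> (f has_vector_derivative 0) (at s)"
  obtains a where "\<And>s. s \<in> I \<Longrightarrow> f s = a"
proof -
  have "\<exists>a. \<forall>s\<in>I. f s = a"
  proof (rule has_derivative_zero_constant)
    show "convex I" using assms(1) by (rule is_interval_convex)
    show "(f has_derivative (\<lambda>h. 0)) (at s within I)" if "s \<in> I" for s
      using assms(2)[OF that] has_derivative_at_withinI by (fastforce simp: has_vector_derivative_def)
  qed
  then show thesis using that by blast
qed

context frenet_curve
begin

text \<open>If \<open>t = m k\<close>, the vector \<open>m T + B\<close> has derivative \<open>(m k - t) N = 0\<close> and is the fixed direction.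
Conversely, if \<open>T \<bullet> d = a\<close> is constant, then \<open>N \<bullet> d = 0\<close> because \<open>k \<noteq> 0\<close>, so that \<open>b = B \<bullet> d\<close> is
constant as well, and the derivative of \<open>N \<bullet> d = 0\<close> reads \<open>t b = k a\<close>. Here \<open>b \<noteq> 0\<close>, as otherwise \<open>d\<close>
would be orthogonal to the whole Frenet frame.\<close>

theorem lancret:
  assumes "is_interval J" "J \<noteq> {}"
  shows "(\<exists>m. \<forall>u\<in>J. torsion \<beta> u / curvature \<beta> u = m) \<longleftrightarrow>
         (\<exists>d a. d \<noteq> 0 \<and> (\<forall>u\<in>J. T u \<bullet> d = a))"
proof
  assume "\<exists>m. \<forall>u\<in>J. torsion \<beta> u / curvature \<beta> u = m"
  then obtain m where m: "torsion \<beta> u = m * curvature \<beta> u" if "u \<in> J" for u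
    using curvature_nonzero by (fastforce simp: divide_simps)
  have "((\<lambda>u. m *\<^sub>R T u + B u) has_vector_derivative 0) (at u)" if "u \<in> J" for u
  proof -
    have "((\<lambda>u. m *\<^sub>R T u + B u) has_vector_derivative
        m *\<^sub>R (curvature \<beta> u *\<^sub>R N u) + - torsion \<beta> u *\<^sub>R N u) (at u)"
      by (intro has_vector_derivative_add frenet_binormal that
          bounded_linear.has_vector_derivative[OF bounded_linear_scaleR_right] frenet_tangent)
    then show ?thesis by (simp add: m[OF that])
  qed
  from zero_derivative_imp_constant[OF assms(1) this]
  obtain d where d: "\<And>u. u \<in> J \<Longrightarrow> m *\<^sub>R T u + B u = d" by blast
  have "T u \<bullet> d = m" if "u \<in> J" for u
    unfolding d[OF that, symmetric]
    using orthonormal[OF that] by (simp add: inner_add_right binormal_def dot_cross_self)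
  moreover have "d \<noteq> 0"
  proof -
    obtain u where u: "u \<in> J" using assms(2) by blast
    have "B u \<bullet> d = 1"
      unfolding d[OF u, symmetric] using norm_binormal[OF u]
      by (simp add: inner_add_right dot_square_norm) (simp add: binormal_def dot_cross_self)
    then show ?thesis by auto
  qed
  ultimately show "\<exists>d a. d \<noteq> 0 \<and> (\<forall>u\<in>J. T u \<bullet> d = a)" by blast
next
  assume "\<exists>d a. d \<noteq> 0 \<and> (\<forall>u\<in>J. T u \<bullet> d = a)"
  then obtain d a where d: "d \<noteq> 0" and Td: "\<And>u. u \<in> J \<Longrightarrow> T u \<bullet> d = a" by blast
  have Nd: "N u \<bullet> d = 0" if "u \<in> J" for u
    using inner_constant_imp_orthogonal_derivative[OF open_J that Td frenet_tangent[OF that]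
        has_vector_derivative_const] curvature_nonzero[OF that] by simp
  have "((\<lambda>u. B u \<bullet> d) has_vector_derivative 0) (at u)" if "u \<in> J" for u
    using bounded_linear.has_vector_derivative[OF bounded_linear_inner_left[of d]
        frenet_binormal[OF that]] by (simp add: Nd[OF that])
  from zero_derivative_imp_constant[OF assms(1) this]
  obtain b where Bd: "\<And>u. u \<in> J \<Longrightarrow> B u \<bullet> d = b" by blast
  have ratio: "torsion \<beta> u * b = curvature \<beta> u * a" if "u \<in> J" for u
    using inner_constant_imp_orthogonal_derivative[OF open_J that Nd frenet_normal[OF that]
        has_vector_derivative_const] by (simp add: inner_diff_left Bd[OF that] Td[OF that])
  have "b \<noteq> 0"
  proof
    assume b: "b = 0"
    obtain u where u: "u \<in> J" using assms(2) by blast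
    have "T u \<bullet> d = 0"
      using ratio[OF u] curvature_nonzero[OF u] Td[OF u] b by simp
    \<comment> \<open>\<open>d\<close> is orthogonal to \<open>T\<close> and \<open>N\<close>, hence parallel to \<open>B\<close>, and also orthogonal to \<open>B\<close>.\<close>
    moreover have "(T u \<bullet> d) *\<^sub>R N u - (N u \<bullet> d) *\<^sub>R T u = cross3 d (cross3 (N u) (T u))"
      by (simp add: cross3_triple_right inner_commute)
    ultimately have "cross3 d (B u) = 0"
      using Nd[OF u] cross_skew[of "N u" "T u"] by (simp add: binormal_def)
    moreover have "d \<bullet> B u = 0"
      using Bd[OF u] b by (simp add: inner_commute)
    ultimately show False
      using norm_and_cross_eq_0[of d "B u"] norm_binormal[OF u] d by auto
  qed
  then have "torsion \<beta> u / curvature \<beta> u = a / b" if "u \<in> J" for u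
    using ratio[OF that] curvature_nonzero[OF that] by (simp add: frac_eq_eq mult.commute)
  then show "\<exists>m. \<forall>u\<in>J. torsion \<beta> u / curvature \<beta> u = m" by blast
qed

text \<open>The angle between lines forgets the sign of \<open>N \<bullet> d\<close>; continuity on a connected set recovers it.\<close>

lemma slant_helix_iff_normal_inner_constant:
  assumes "connected J"
  shows "slant_helix J \<beta> \<longleftrightarrow> (\<exists>d a. d \<noteq> 0 \<and> (\<forall>u\<in>J. N u \<bullet> d = a))"
proof
  assume "slant_helix J \<beta>"
  then obtain d \<theta> where d: "d \<noteq> 0" and \<theta>: "\<And>u. u \<in> J \<Longrightarrow> line_angle (N u) d = \<theta>"
    unfolding slant_helix_def by blast
  have abs: "\<bar>N u \<bullet> d\<bar> = norm d * cos \<theta>" if "u \<in> J" for u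
  proof -
    have "arccos (\<bar>N u \<bullet> d\<bar> / norm d) = \<theta>" and "\<bar>N u \<bullet> d\<bar> \<le> norm d"
      using \<theta>[OF that] Cauchy_Schwarz_ineq2[of "N u" d]
      by (simp_all add: line_angle_def norm_normal[OF that])
    moreover from this have "cos (arccos (\<bar>N u \<bullet> d\<bar> / norm d)) = \<bar>N u \<bullet> d\<bar> / norm d"
      using d by (intro cos_arccos) (auto simp: divide_simps intro: order_trans[of _ 0])
    ultimately show ?thesis using d by (simp add: divide_simps mult.commute)
  qed
  have "(\<lambda>u. N u \<bullet> d) constant_on J"
  proof (rule continuous_finite_range_constant[OF assms])
    show "continuous_on J (\<lambda>u. N u \<bullet> d)"
      by (intro continuous_intros smooth_on_continuous_on smooth_normal)
    have "(\<lambda>u. N u \<bullet> d) ` J \<subseteq> {norm d * cos \<theta>, - (norm d * cos \<theta>)}"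
      using abs by force
    then show "finite ((\<lambda>u. N u \<bullet> d) ` J)"
      by (rule finite_subset) simp
  qed
  then show "\<exists>d a. d \<noteq> 0 \<and> (\<forall>u\<in>J. N u \<bullet> d = a)"
    using d unfolding constant_on_def by blast
next
  assume "\<exists>d a. d \<noteq> 0 \<and> (\<forall>u\<in>J. N u \<bullet> d = a)"
  then obtain d a where d: "d \<noteq> 0" "\<And>u. u \<in> J \<Longrightarrow> N u \<bullet> d = a" by blast
  have "line_angle (N u) d = arccos (\<bar>a\<bar> / norm d)" if "u \<in> J" for u
    using norm_normal[OF that] d(2)[OF that] by (simp add: line_angle_def)
  then show "slant_helix J \<beta>"
    using d(1) unfolding slant_helix_def by blast
qed

end

section \<open>Arc-length reparametrizations\<close>

text \<open>The interval may be unbounded on either side; its end points are taken in the extended reals.\<close>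

lemma antiderivative_on_open_interval:
  fixes f :: "real \<Rightarrow> 'a::euclidean_space"
  assumes "open I" "is_interval I" "continuous_on I f"
  obtains F where "\<And>s. s \<in> I \<Longrightarrow> (F has_vector_derivative f s) (at s)"
proof (cases "I = {}")
  case False
  define a b where "a = Inf (ereal ` I)" and "b = Sup (ereal ` I)"
  have bounds: "a < ereal s \<and> ereal s < b" if "s \<in> I" for s
  proof -
    have "\<exists>e>0. cball s e \<subseteq> I"
      using open_contains_cball_eq[OF assms(1)] that by simp
    then obtain e where e: "e > 0" "cball s e \<subseteq> I" by blast
    have "s - e \<in> cball s e" "s + e \<in> cball s e"
      using e(1) by (simp_all add: dist_real_def)
    with e(2) have "s - e \<in> I" "s + e \<in> I" by auto
    then have "a \<le> ereal (s - e)" "ereal (s + e) \<le> b"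
      unfolding a_def b_def by (auto intro: Inf_lower Sup_upper)
    then show ?thesis
      using e(1) le_less_trans[of a "ereal (s - e)" "ereal s"]
        less_le_trans[of "ereal s" "ereal (s + e)" b] by simp
  qed
  have inside: "s \<in> I" if s: "a < ereal s" "ereal s < b" for s
  proof -
    obtain p q where pq: "p \<in> I" "q \<in> I" "p < s" "s < q"
      using s unfolding a_def b_def Inf_less_iff less_Sup_iff by auto
    show ?thesis
      using mem_is_interval_1_I[OF assms(2) pq(1,2)] pq(3,4) by simp
  qed
  have "a < b" using False bounds less_trans by blast
  moreover have "isCont f s" if "a < ereal s" "ereal s < b" for s
    using assms(1,3) inside[OF that] by (simp add: continuous_on_eq_continuous_at)
  ultimately show thesis
    using einterval_antiderivative[of a b f] bounds that by blast
qed (use that in auto)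

text \<open>The arc length \<open>\<phi>\<close>, an antiderivative of the speed, is strictly increasing. Its inverse \<open>\<psi>\<close> solves
\<open>\<psi>' = 1 / (v \<circ> \<psi>)\<close> with \<open>v\<close> the speed, so it is smooth and \<open>\<alpha> \<circ> \<psi>\<close> has unit speed.\<close>

theorem exists_arclength_reparam:
  fixes \<alpha> :: "real \<Rightarrow> real^3"
  assumes "open I" "is_interval I" "smooth_on I \<alpha>"
    and regular: "\<And>s. s \<in> I \<Longrightarrow> vderiv \<alpha> s \<noteq> 0"
  obtains J \<beta> \<phi> where "arclength_reparam I \<alpha> J \<beta> \<phi>"
proof -
  define v where "v s = norm (vderiv \<alpha> s)" for s
  have v_pos: "v s > 0" if "s \<in> I" for s
    using regular[OF that] by (simp add: v_def)
  have smooth_v: "smooth_on I v"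
    unfolding v_def using regular by (intro smooth_on_norm smooth_on_vderiv assms)
  obtain \<phi> where \<phi>: "\<And>s. s \<in> I \<Longrightarrow> (\<phi> has_vector_derivative v s) (at s)"
    using antiderivative_on_open_interval[OF assms(1,2) smooth_on_continuous_on[OF smooth_v]]
    by blast
  have smooth_\<phi>: "smooth_on I \<phi>"
    using smooth_onI[OF assms(1) \<phi> smooth_v] .
  have "strict_mono_on I \<phi>"
  proof (rule strict_mono_onI)
    fix s t assume st: "s \<in> I" "t \<in> I" "s < t"
    show "\<phi> s < \<phi> t"
    proof (rule DERIV_pos_imp_increasing[OF st(3)])
      fix x assume "s \<le> x" "x \<le> t"
      then have "x \<in> I"
        using mem_is_interval_1_I[OF assms(2) st(1,2)] by blast
      then show "\<exists>y. (\<phi> has_real_derivative y) (at x) \<and> y > 0"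
        using \<phi> v_pos by (auto simp: has_real_derivative_iff_has_vector_derivative)
    qed
  qed
  then have inj: "inj_on \<phi> I"
    by (rule strict_mono_on_imp_inj_on)
  define J where "J = \<phi> ` I"
  define \<psi> where "\<psi> = inv_into I \<phi>"
  have \<psi>_\<phi>: "\<psi> (\<phi> s) = s" if "s \<in> I" for s
    using inj that by (simp add: \<psi>_def)
  have \<psi>_in: "\<psi> y \<in> I" "\<phi> (\<psi> y) = y" if "y \<in> J" for y
    using that \<psi>_\<phi> by (auto simp: J_def)
  have open_J: "open J"
    unfolding J_def by (rule invariance_of_domain[OF smooth_on_continuous_on[OF smooth_\<phi>] assms(1) inj])
  have \<psi>: "(\<psi> has_vector_derivative inverse (v (\<psi> y))) (at y)" if y: "y \<in> J" for y
  proof -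
    let ?s = "\<psi> y"
    have "(\<psi> has_derivative (\<lambda>h. h * inverse (v ?s))) (at (\<phi> ?s))"
    proof (rule has_derivative_inverse_strong[OF assms(1) \<psi>_in(1)[OF y]])
      show "continuous_on I \<phi>" by (rule smooth_on_continuous_on[OF smooth_\<phi>])
      show "(\<phi> has_derivative (\<lambda>h. h * v ?s)) (at ?s)"
        using \<phi>[OF \<psi>_in(1)[OF y]] by (simp add: has_vector_derivative_def)
      show "(\<lambda>h. h * v ?s) \<circ> (\<lambda>h. h * inverse (v ?s)) = id"
        using v_pos[OF \<psi>_in(1)[OF y]] by auto
    qed (rule \<psi>_\<phi>)
    then show ?thesis
      using \<psi>_in(2)[OF y] by (simp add: has_vector_derivative_def)
  qed
  have smooth_\<psi>: "smooth_on J \<psi>"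
  proof (rule smooth_on_autonomous_solution[where F = "\<lambda>s. inverse (v s)" and J = I])
    show "smooth_on I (\<lambda>s. inverse (v s))"
      using v_pos by (intro smooth_on_inverse assms(1) smooth_v) force
  qed (use open_J \<psi> \<psi>_in in auto)
  have "unit_speed_on J (\<lambda>y. \<alpha> (\<psi> y))"
    unfolding unit_speed_on_def
  proof (intro conjI ballI)
    show "smooth_on J (\<lambda>y. \<alpha> (\<psi> y))"
      by (rule smooth_on_compose[OF open_J _ assms(3) smooth_\<psi>]) (use \<psi>_in in auto)
    fix y assume y: "y \<in> J"
    have "((\<lambda>y. \<alpha> (\<psi> y)) has_vector_derivative inverse (v (\<psi> y)) *\<^sub>R vderiv \<alpha> (\<psi> y)) (at y)"
      using vector_diff_chain_at[OF \<psi>[OF y] smooth_onD[OF assms(3) \<psi>_in(1)[OF y]]]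
      by (simp add: o_def)
    then have "vderiv (\<lambda>y. \<alpha> (\<psi> y)) y = inverse (v (\<psi> y)) *\<^sub>R vderiv \<alpha> (\<psi> y)"
      by (rule vderiv_eqI)
    then show "norm (vderiv (\<lambda>y. \<alpha> (\<psi> y)) y) = 1"
      using v_pos[OF \<psi>_in(1)[OF y]] by (simp add: v_def)
  qed
  moreover have "is_interval J"
    unfolding J_def is_interval_connected_1
    using assms(2) smooth_on_continuous_on[OF smooth_\<phi>]
    by (simp add: connected_continuous_image is_interval_connected_1)
  moreover have "bij_betw \<phi> I J"
    using inj by (simp add: J_def bij_betw_def)
  moreover have "vderiv \<phi> s > 0" if "s \<in> I" for s
    using vderiv_eqI[OF \<phi>[OF that]] v_pos[OF that] by simp
  ultimately have "arclength_reparam I \<alpha> J (\<lambda>y. \<alpha> (\<psi> y)) \<phi>"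
    using open_J smooth_\<phi> \<psi>_\<phi> by (simp add: arclength_reparam_def)
  then show thesis by (rule that)
qed

section \<open>The involute\<close>

context frenet_curve
begin

lemma involute_has_vector_derivative:
  assumes "u \<in> J"
  shows "(involute c \<beta> has_vector_derivative ((c - u) * curvature \<beta> u) *\<^sub>R N u) (at u)"
proof -
  have "(\<beta> has_vector_derivative T u) (at u)"
    using unit_speed assms by (auto simp: unit_speed_on_def unit_tangent_def intro: smooth_onD)
  moreover have "((\<lambda>s. c - s) has_vector_derivative 0 - 1) (at u)"
    by (intro has_vector_derivative_diff has_vector_derivative_const has_vector_derivative_id)
  ultimately have "((\<lambda>s. \<beta> s + (c - s) *\<^sub>R T s) has_vector_derivative
      T u + ((c - u) *\<^sub>R (curvature \<beta> u *\<^sub>R N u) + (0 - 1) *\<^sub>R T u)) (at u)"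
    by (intro has_vector_derivative_add frenet_tangent[OF assms]
        bounded_bilinear.has_vector_derivative[OF bounded_bilinear_scaleR])
  then show ?thesis
    by (simp add: involute_def[abs_def])
qed

lemma smooth_involute: "smooth_on J (involute c \<beta>)"
proof (rule smooth_onI[OF open_J involute_has_vector_derivative])
  have "smooth_on J (\<lambda>u. c + - u)"
    by (intro smooth_on_add smooth_on_uminus smooth_on_const smooth_on_ident open_J)
  then show "smooth_on J (\<lambda>u. ((c - u) * curvature \<beta> u) *\<^sub>R N u)"
    by (intro smooth_on_scaleR smooth_on_bilinear[OF bounded_bilinear_mult] open_J
        smooth_normal smooth_curvature) simp
qed

text \<open>Comparing the chain rule for \<open>\<eta> \<circ> \<phi>\<close> with the derivative of the involute, the norms give
\<open>\<phi>' = (c - u) k\<close>; this is where \<open>c - u > 0\<close> excludes the opposite direction \<open>- N\<close>.\<close>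

lemma involute_reparam_tangent:
  assumes reparam: "arclength_reparam J (involute c \<beta>) K \<eta> \<phi>" and "u \<in> J" "c - u > 0"
  shows "unit_tangent \<eta> (\<phi> u) = N u"
proof -
  have "\<phi> u \<in> K"
    using reparam assms(2) by (auto simp: arclength_reparam_def bij_betw_def)
  then have \<eta>: "(\<eta> has_vector_derivative vderiv \<eta> (\<phi> u)) (at (\<phi> u))"
    and unit: "norm (vderiv \<eta> (\<phi> u)) = 1"
    using reparam by (auto simp: arclength_reparam_def unit_speed_on_def intro: smooth_onD)
  have \<phi>: "(\<phi> has_vector_derivative vderiv \<phi> u) (at u)" and \<phi>_pos: "vderiv \<phi> u > 0"
    using reparam assms(2) by (auto simp: arclength_reparam_def intro: smooth_onD)
  have "(involute c \<beta> has_vector_derivative vderiv \<phi> u *\<^sub>R vderiv \<eta> (\<phi> u)) (at u)"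
    by (rule has_vector_derivative_transform_within_open[OF vector_diff_chain_at[OF \<phi> \<eta>] open_J assms(2)])
       (use reparam in \<open>simp add: arclength_reparam_def\<close>)
  then have eq: "vderiv \<phi> u *\<^sub>R vderiv \<eta> (\<phi> u) = ((c - u) * curvature \<beta> u) *\<^sub>R N u"
    using vector_derivative_unique_at involute_has_vector_derivative[OF assms(2)] by blast
  have "vderiv \<phi> u = (c - u) * curvature \<beta> u"
    using arg_cong[OF eq, of norm] unit norm_normal[OF assms(2)] \<phi>_pos assms(3) curvature_pos[OF assms(2)] by simp
  then show ?thesis
    using eq assms(3) curvature_nonzero[OF assms(2)] by (simp add: unit_tangent_def)
qed

text \<open>The curvature of the involute is \<open>norm N'\<close> up to a positive factor, so it suffices that \<open>N' \<noteq> 0\<close>.\<close>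

lemma involute_reparam_frenet_curve:
  assumes reparam: "arclength_reparam J (involute c \<beta>) K \<eta> \<phi>"
    and pos: "\<And>u. u \<in> J \<Longrightarrow> c - u > 0"
  shows "frenet_curve K \<eta>"
proof
  show "open K" "unit_speed_on K \<eta>"
    using reparam by (auto simp: arclength_reparam_def)
  fix y assume "y \<in> K"
  then obtain u where u: "u \<in> J" "y = \<phi> u"
    using reparam by (auto simp: arclength_reparam_def bij_betw_def)
  have \<phi>: "(\<phi> has_vector_derivative vderiv \<phi> u) (at u)"
    using reparam u(1) by (auto simp: arclength_reparam_def intro: smooth_onD)
  have "smooth_on K (unit_tangent \<eta>)"
    using reparam unfolding arclength_reparam_def unit_speed_on_def unit_tangent_def
    by (blast intro: smooth_on_vderiv)
  then have "(unit_tangent \<eta> has_vector_derivative vderiv (unit_tangent \<eta>) (\<phi> u)) (at (\<phi> u))"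
    using \<open>y \<in> K\<close> u(2) by (simp add: smooth_onD)
  from vector_diff_chain_at[OF \<phi> this]
  have N': "(N has_vector_derivative vderiv \<phi> u *\<^sub>R vderiv (unit_tangent \<eta>) (\<phi> u)) (at u)"
    by (rule has_vector_derivative_transform_within_open[OF _ open_J u(1)])
       (simp add: involute_reparam_tangent[OF reparam _ pos])
  \<comment> \<open>Differentiating \<open>T \<bullet> N = 0\<close> gives \<open>T \<bullet> N' = - curvature\<close>.\<close>
  have "T u \<bullet> (vderiv \<phi> u *\<^sub>R vderiv (unit_tangent \<eta>) (\<phi> u)) + curvature \<beta> u = 0"
    using inner_constant_imp_orthogonal_derivative[OF open_J u(1) orthonormal(3)
        frenet_tangent[OF u(1)] N'] orthonormal(2)[OF u(1)] by simp
  then show "curvature \<eta> y \<noteq> 0"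
    using curvature_nonzero[OF u(1)] u(2) by (auto simp: curvature_def)
qed

text \<open>Lancret's theorem for the involute, whose unit tangent is \<open>N\<close>. The criterion does not mention the
reparametrization, which is why an existentially quantified one can be used for both implications.\<close>

lemma helix_reparam_iff_normal_inner_constant:
  assumes reparam: "arclength_reparam J (involute c \<beta>) K \<eta> \<phi>"
    and pos: "\<And>u. u \<in> J \<Longrightarrow> c - u > 0" and "J \<noteq> {}"
  shows "(\<exists>m. \<forall>y\<in>K. torsion \<eta> y / curvature \<eta> y = m) \<longleftrightarrow>
         (\<exists>d a. d \<noteq> 0 \<and> (\<forall>u\<in>J. N u \<bullet> d = a))"
proof -
  interpret \<eta>: frenet_curve K \<eta>
    by (rule involute_reparam_frenet_curve[OF reparam pos])
  have K: "is_interval K" "K = \<phi> ` J"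
    using reparam by (auto simp: arclength_reparam_def bij_betw_def)
  have "(\<forall>y\<in>K. unit_tangent \<eta> y \<bullet> d = a) \<longleftrightarrow> (\<forall>u\<in>J. N u \<bullet> d = a)" for d a
    by (simp add: K(2) involute_reparam_tangent[OF reparam _ pos])
  then show ?thesis
    using \<eta>.lancret[OF K(1)] K(2) assms(3) by simp
qed

end

theorem theorem2:
  fixes \<gamma> :: "real \<Rightarrow> real^3" and I :: "real set" and c :: real
  assumes "open I" and "is_interval I" and "I \<noteq> {}"
    and "unit_speed_on I \<gamma>"
    and "\<And>s. s \<in> I \<Longrightarrow> curvature \<gamma> s \<noteq> 0"
    and "\<And>s. s \<in> I \<Longrightarrow> c - s > 0"
  shows "generalized_helix I (involute c \<gamma>) \<longleftrightarrow> slant_helix I \<gamma>"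
proof -
  interpret frenet_curve I \<gamma>
    by standard (use assms in auto)
  have "slant_helix I \<gamma> \<longleftrightarrow> (\<exists>d a. d \<noteq> 0 \<and> (\<forall>s\<in>I. N s \<bullet> d = a))" (is "_ \<longleftrightarrow> ?const")
    using slant_helix_iff_normal_inner_constant assms(2) by (simp add: is_interval_connected_1)
  moreover have "generalized_helix I (involute c \<gamma>) \<longleftrightarrow> ?const"
  proof
    assume "generalized_helix I (involute c \<gamma>)"
    then show ?const
      unfolding generalized_helix_def
      using helix_reparam_iff_normal_inner_constant[OF _ assms(6,3)] by blast
  next
    assume const: ?const
    have "vderiv (involute c \<gamma>) s \<noteq> 0" if "s \<in> I" for s
      using assms(5,6)[OF that] orthonormal(2)[OF that]
      by (auto simp: vderiv_eqI[OF involute_has_vector_derivative[OF that]])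
    then obtain J \<beta> \<phi> where reparam: "arclength_reparam I (involute c \<gamma>) J \<beta> \<phi>"
      using exists_arclength_reparam[OF assms(1,2) smooth_involute] by blast
    moreover have "\<forall>u\<in>J. curvature \<beta> u > 0"
      using frenet_curve.curvature_pos[OF involute_reparam_frenet_curve[OF reparam assms(6)]] by blast
    moreover have "\<exists>m. \<forall>u\<in>J. torsion \<beta> u / curvature \<beta> u = m"
      using helix_reparam_iff_normal_inner_constant[OF reparam assms(6,3)] const by blast
    ultimately show "generalized_helix I (involute c \<gamma>)"
      unfolding generalized_helix_def by blast
  qed
  ultimately show ?thesis by blast
qed

end
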